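(* Let $f\colon\Omega\to\mathbb{R}$ be a real-valued convex function defined on a nonempty convex subset $\Omega$ of a normed space $X$, let $\sigma\ge 0$, and let $\varphi\colon\mathbb{R}\to[-\infty,\infty]$ be a function that is $\sigma$-quasiconvex and nondecreasing on an interval $I$ containing $f(\Omega)$. Suppose further that there exists $\ell\ge 0$ such that $$\ell\|x-u\|\le|f(x)-f(u)|\quad\text{for all }x,u\in\Omega.$$ Then $\varphi\circ f$ is $\sigma\ell^2$-quasiconvex on $\Omega$.
   Context: All normed vector spaces are real and nontrivial. Let $\sigma\ge 0$. A function $g$ with values in $[-\infty,\infty]$ is $\sigma$-quasiconvex on a nonempty convex subset $C$ of a normed vector space if $g(\lambda x+(1-\lambda)y)\le\max\{g(x),g(y)\}-\frac{\sigma}{2}\lambda(1-\lambda)\|x-y\|^2$ for all $x,y\in C$ and $0<\lambda<1$. On $\mathbb{R}$ the norm is the absolute value. *)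

theory Defs
  imports "HOL-Analysis.Analysis"
begin

text \<open>
  The subtracted term is a real number, so the \<^typ>\<open>ereal\<close> subtraction below is never of the
  form \<open>\<infinity> - \<infinity>\<close>: it is the usual one, with \<open>\<plusminus>\<infinity> - r = \<plusminus>\<infinity>\<close>. The inequality is only
  imposed at points of \<open>C\<close>; the values of \<open>g\<close> elsewhere are irrelevant.
\<close>

definition quasiconvex_on :: "real \<Rightarrow> 'a::real_normed_vector set \<Rightarrow> ('a \<Rightarrow> ereal) \<Rightarrow> bool" where
  "quasiconvex_on \<sigma> C g \<longleftrightarrow>
     0 \<le> \<sigma> \<and> C \<noteq> {} \<and> convex C \<and>
     (\<forall>x\<in>C. \<forall>y\<in>C. \<forall>t::real. 0 < t \<and> t < 1 \<longrightarrow>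
        g (t *\<^sub>R x + (1 - t) *\<^sub>R y)
          \<le> max (g x) (g y) - ereal (\<sigma> / 2 * t * (1 - t) * (norm (x - y))\<^sup>2))"

end

theory Submission
  imports Defs
begin

text \<open>
  Convexity of \<open>f\<close> and monotonicity of \<open>\<phi>\<close> bound \<open>\<phi> (f (t x + (1 - t) y))\<close> by
  \<open>\<phi> (t f x + (1 - t) f y)\<close>; quasiconvexity of \<open>\<phi>\<close> then yields a decrement quadratic in
  \<open>\<bar>f x - f y\<bar>\<close>, which dominates \<open>l * norm (x - y)\<close>.
\<close>

theorem proposition2p2:
  fixes f :: "'a::real_normed_vector \<Rightarrow> real"
    and \<Omega> :: "'a set"
    and \<phi> :: "real \<Rightarrow> ereal"
    and I :: "real set"
    and \<sigma> l :: real
  assumes nontrivial: "\<exists>v::'a. v \<noteq> 0"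
    and "\<Omega> \<noteq> {}" and "convex \<Omega>"
    and "convex_on \<Omega> f"
    and "0 \<le> \<sigma>"
    and "is_interval I" and "f ` \<Omega> \<subseteq> I"
    and "quasiconvex_on \<sigma> I \<phi>"
    and "mono_on I \<phi>"
    and "0 \<le> l"
    and "\<And>x u. x \<in> \<Omega> \<Longrightarrow> u \<in> \<Omega> \<Longrightarrow> l * norm (x - u) \<le> \<bar>f x - f u\<bar>"
  shows "quasiconvex_on (\<sigma> * l\<^sup>2) \<Omega> (\<phi> \<circ> f)"
proof -
  have "(\<phi> \<circ> f) (t *\<^sub>R x + (1 - t) *\<^sub>R y)
      \<le> max ((\<phi> \<circ> f) x) ((\<phi> \<circ> f) y)
        - ereal (\<sigma> * l\<^sup>2 / 2 * t * (1 - t) * (norm (x - y))\<^sup>2)"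
    if x: "x \<in> \<Omega>" and y: "y \<in> \<Omega>" and t: "0 < t" "t < 1" for x y and t :: real
  proof -
    define z where "z = t *\<^sub>R x + (1 - t) *\<^sub>R y"
    \<comment> \<open>\<open>*\<^sub>R\<close> is used even on the reals so that \<open>w\<close>
      matches the convex combination in \<open>quasiconvex_on\<close> literally.\<close>
    define w where "w = t *\<^sub>R f x + (1 - t) *\<^sub>R f y"
    have fI: "f x \<in> I" "f y \<in> I"
      using x y \<open>f ` \<Omega> \<subseteq> I\<close> by auto
    have z: "z \<in> \<Omega>"
      unfolding z_def using \<open>convex \<Omega>\<close> x y t by (intro convexD) auto
    \<comment> \<open>The image of \<open>f\<close> need not be an interval, so \<open>w\<close> may
      fail to be a value of \<open>f\<close>; it lies in \<open>I\<close> because intervals are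
      convex.\<close>
    have "convex I"
      using \<open>is_interval I\<close> by (rule is_interval_convex)
    then have w: "w \<in> I"
      unfolding w_def using fI t by (intro convexD) auto
    \<comment> \<open>\<open>convex_onD\<close> puts its parameter on the second point, so
      \<open>1 - t\<close> leaves weight \<open>t\<close> on \<open>x\<close>.\<close>
    have "f z \<le> w"
      using convex_onD[OF \<open>convex_on \<Omega> f\<close>, of "1 - t" x y] x y t
      by (simp add: z_def w_def)
    then have "\<phi> (f z) \<le> \<phi> w"
      using \<open>mono_on I \<phi>\<close> z w \<open>f ` \<Omega> \<subseteq> I\<close> by (auto intro: mono_onD)
    also have "\<dots> \<le> max (\<phi> (f x)) (\<phi> (f y))
        - ereal (\<sigma> / 2 * t * (1 - t) * (norm (f x - f y))\<^sup>2)"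
      using \<open>quasiconvex_on \<sigma> I \<phi>\<close> fI t unfolding quasiconvex_on_def w_def by blast
    also have "\<dots> \<le> max (\<phi> (f x)) (\<phi> (f y))
        - ereal (\<sigma> * l\<^sup>2 / 2 * t * (1 - t) * (norm (x - y))\<^sup>2)"
    proof -
      \<comment> \<open>Squaring preserves the expansion bound because \<open>0 \<le> l\<close>
        makes its left side nonnegative.\<close>
      have "(l * norm (x - y))\<^sup>2 \<le> (norm (f x - f y))\<^sup>2"
        using assms(11)[OF x y] \<open>0 \<le> l\<close> by (intro power_mono) auto
      then have "\<sigma> / 2 * t * (1 - t) * (l * norm (x - y))\<^sup>2
          \<le> \<sigma> / 2 * t * (1 - t) * (norm (f x - f y))\<^sup>2"
        using \<open>0 \<le> \<sigma>\<close> t by (intro mult_left_mono) auto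
      \<comment> \<open>Pulling \<open>l\<^sup>2\<close> out of the square gives the modulus
        \<open>\<sigma> * l\<^sup>2\<close>; subtracting a smaller real gives a larger value, even
        if the maximum is infinite.\<close>
      then show ?thesis
        by (intro ereal_minus_mono) (simp_all add: power_mult_distrib mult_ac)
    qed
    finally show ?thesis
      by (simp add: z_def)
  qed
  then show ?thesis
    using \<open>0 \<le> \<sigma>\<close> \<open>\<Omega> \<noteq> {}\<close> \<open>convex \<Omega>\<close> by (simp add: quasiconvex_on_def)
qed

end
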